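(* The Bergman shift $B_+$ (the unilateral weighted shift with weights $\omega_n=\sqrt{\frac{n+1}{n+2}}$, $n\ge0$) admits a spherically isometric embedding whose Berger measure is normalized arclength on the line segment $\{(s,t)\in\mathbb{R}_+^2: s+t=1\}$.
   Context: $\mathbb{Z}_+=\{0,1,2,\dots\}$ and $\mathbb{R}_+=[0,\infty)$. A unilateral weighted shift $W_\omega$ with bounded positive weights $\omega=\{\omega_n\}$ acts on $\ell^2(\mathbb{Z}_+)$ by $W_\omega e_n=\omega_ne_{n+1}$; its moments are $\gamma_0=1$, $\gamma_k=\omega_0^2\cdots\omega_{k-1}^2$. $W_\omega$ is subnormal iff there is a probability measure $\sigma$ on $[0,\|W_\omega\|^2]$ (its Berger measure) with $\gamma_k=\int r^kd\sigma(r)$ for all $k\ge0$. The Berger measure of $B_+$ is Lebesgue measure on $[0,1]$. A $2$-variable weighted shift $W_{(\alpha,\beta)}\equiv(T_1,T_2)$, with bounded positive weights $\alpha_{\mathbf k},\beta_{\mathbf k}$ ($\mathbf k\in\mathbb{Z}_+^2$), acts on $\ell^2(\mathbb{Z}_+^2)$ by $T_1e_{\mathbf k}=\alpha_{\mathbf k}e_{\mathbf k+(1,0)}$, $T_2e_{\mathbf k}=\beta_{\mathbf k}e_{\mathbf k+(0,1)}$, and is assumed commuting. Its moment $\gamma_{(k_1,k_2)}$ is the product of the squares of the weights along any nondecreasing lattice path from $(0,0)$ to $(k_1,k_2)$. It is (jointly) subnormal iff there is a probability measure $\mu$ on $[0,\|T_1\|^2]\times[0,\|T_2\|^2]$ (its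 Berger measure) with $\gamma_{(k_1,k_2)}=\int s^{k_1}t^{k_2}d\mu(s,t)$ for all $k_1,k_2\ge0$. A spherically isometric embedding of a subnormal $W_\omega$ with Berger measure $\sigma$ supported in $[0,1]$ is the $2$-variable weighted shift with moments $\gamma_{(k_1,k_2)}=\int r^{k_1}(1-r)^{k_2}d\sigma(r)$; its weights satisfy $\alpha_{\mathbf k}^2+\beta_{\mathbf k}^2=1$ for all $\mathbf k\in\mathbb{Z}_+^2$, i.e. $T_1^*T_1+T_2^*T_2=I$ (spherical isometry). Normalized arclength means arclength measure scaled to have total mass $1$. *)

theory Defs
  imports "HOL-Probability.Probability"
begin

section \<open>Square-summable families and operators on them\<close>

definition ell2 :: "('a \<Rightarrow> complex) set" where
  "ell2 = {x. (\<lambda>k. (cmod (x k))\<^sup>2) summable_on UNIV}"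

definition ell2_inner :: "('a \<Rightarrow> complex) \<Rightarrow> ('a \<Rightarrow> complex) \<Rightarrow> complex" where
  "ell2_inner x y = (\<Sum>\<^sub>\<infinity>k. x k * cnj (y k))"

definition ell2_norm :: "('a \<Rightarrow> complex) \<Rightarrow> real" where
  "ell2_norm x = sqrt (\<Sum>\<^sub>\<infinity>k. (cmod (x k))\<^sup>2)"

definition ell2_opnorm :: "(('a \<Rightarrow> complex) \<Rightarrow> ('b \<Rightarrow> complex)) \<Rightarrow> real" where
  "ell2_opnorm T = (SUP x\<in>{x \<in> ell2. ell2_norm x \<le> 1}. ell2_norm (T x))"

definition ell2_adjoint_of ::
  "(('a \<Rightarrow> complex) \<Rightarrow> ('a \<Rightarrow> complex)) \<Rightarrow> (('a \<Rightarrow> complex) \<Rightarrow> ('a \<Rightarrow> complex)) \<Rightarrow> bool" where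
  "ell2_adjoint_of T S \<longleftrightarrow>
     (\<forall>x\<in>ell2. T x \<in> ell2 \<and> S x \<in> ell2) \<and>
     (\<forall>x\<in>ell2. \<forall>y\<in>ell2. ell2_inner (T x) y = ell2_inner x (S y))"

text \<open>\<open>S\<^sub>1\<close> and \<open>S\<^sub>2\<close> are the Hilbert space adjoints, so this is
  \<open>T\<^sub>1\<^sup>* T\<^sub>1 + T\<^sub>2\<^sup>* T\<^sub>2 = I\<close>.\<close>

definition spherical_isometry ::
  "(('a \<Rightarrow> complex) \<Rightarrow> ('a \<Rightarrow> complex)) \<Rightarrow> (('a \<Rightarrow> complex) \<Rightarrow> ('a \<Rightarrow> complex)) \<Rightarrow> bool" where
  "spherical_isometry T\<^sub>1 T\<^sub>2 \<longleftrightarrow>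
     (\<exists>S\<^sub>1 S\<^sub>2. ell2_adjoint_of T\<^sub>1 S\<^sub>1 \<and> ell2_adjoint_of T\<^sub>2 S\<^sub>2 \<and>
        (\<forall>x\<in>ell2. (\<lambda>k. S\<^sub>1 (T\<^sub>1 x) k + S\<^sub>2 (T\<^sub>2 x) k) = x))"


section \<open>Unilateral weighted shifts\<close>

definition shift_weights :: "(nat \<Rightarrow> real) \<Rightarrow> bool" where
  "shift_weights \<omega> \<longleftrightarrow> (\<forall>n. \<omega> n > 0) \<and> bdd_above (range \<omega>)"

definition weighted_shift :: "(nat \<Rightarrow> real) \<Rightarrow> (nat \<Rightarrow> complex) \<Rightarrow> (nat \<Rightarrow> complex)" where
  "weighted_shift \<omega> x = (\<lambda>n. case n of 0 \<Rightarrow> 0 | Suc m \<Rightarrow> of_real (\<omega> m) * x m)"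

lemma weighted_shift_basis:
  "weighted_shift \<omega> (\<lambda>i. of_bool (i = n)) = (\<lambda>i. of_real (\<omega> n) * of_bool (i = Suc n))"
  by (auto simp: weighted_shift_def fun_eq_iff split: nat.split)

definition moment :: "(nat \<Rightarrow> real) \<Rightarrow> nat \<Rightarrow> real" where
  "moment \<omega> k = (\<Prod>i<k. (\<omega> i)\<^sup>2)"

definition berger_measure :: "(nat \<Rightarrow> real) \<Rightarrow> real measure \<Rightarrow> bool" where
  "berger_measure \<omega> \<sigma> \<longleftrightarrow>
     prob_space \<sigma> \<and> sets \<sigma> = sets borel \<and>
     (AE r in \<sigma>. r \<in> {0..(ell2_opnorm (weighted_shift \<omega>))\<^sup>2}) \<and>
     (\<forall>k. moment \<omega> k = (\<integral>r. r ^ k \<partial>\<sigma>))"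

definition bergman_weights :: "nat \<Rightarrow> real" where
  "bergman_weights n = sqrt ((real n + 1) / (real n + 2))"


section \<open>2-variable weighted shifts\<close>

definition shift1 ::
  "(nat \<times> nat \<Rightarrow> real) \<Rightarrow> (nat \<times> nat \<Rightarrow> complex) \<Rightarrow> (nat \<times> nat \<Rightarrow> complex)" where
  "shift1 \<alpha> x = (\<lambda>(i, j). case i of 0 \<Rightarrow> 0 | Suc m \<Rightarrow> of_real (\<alpha> (m, j)) * x (m, j))"

definition shift2 ::
  "(nat \<times> nat \<Rightarrow> real) \<Rightarrow> (nat \<times> nat \<Rightarrow> complex) \<Rightarrow> (nat \<times> nat \<Rightarrow> complex)" where
  "shift2 \<beta> x = (\<lambda>(i, j). case j of 0 \<Rightarrow> 0 | Suc m \<Rightarrow> of_real (\<beta> (i, m)) * x (i, m))"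

lemma shift1_basis:
  "shift1 \<alpha> (\<lambda>k. of_bool (k = (m, n))) = (\<lambda>k. of_real (\<alpha> (m, n)) * of_bool (k = (Suc m, n)))"
  by (auto simp: shift1_def fun_eq_iff split: nat.split)

lemma shift2_basis:
  "shift2 \<beta> (\<lambda>k. of_bool (k = (m, n))) = (\<lambda>k. of_real (\<beta> (m, n)) * of_bool (k = (m, Suc n)))"
  by (auto simp: shift2_def fun_eq_iff split: nat.split)

definition shift_weights_2 :: "(nat \<times> nat \<Rightarrow> real) \<Rightarrow> (nat \<times> nat \<Rightarrow> real) \<Rightarrow> bool" where
  "shift_weights_2 \<alpha> \<beta> \<longleftrightarrow>
     (\<forall>k. \<alpha> k > 0) \<and> (\<forall>k. \<beta> k > 0) \<and> bdd_above (range \<alpha>) \<and> bdd_above (range \<beta>) \<and>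
     (\<forall>x\<in>ell2. shift1 \<alpha> (shift2 \<beta> x) = shift2 \<beta> (shift1 \<alpha> x))"

text \<open>The moment is computed along the lattice path from \<open>(0, 0)\<close> through \<open>(k\<^sub>1, 0)\<close> to
  \<open>(k\<^sub>1, k\<^sub>2)\<close>; for commuting shifts every nondecreasing path gives the same value.\<close>

definition moment2 ::
  "(nat \<times> nat \<Rightarrow> real) \<Rightarrow> (nat \<times> nat \<Rightarrow> real) \<Rightarrow> nat \<Rightarrow> nat \<Rightarrow> real" where
  "moment2 \<alpha> \<beta> k\<^sub>1 k\<^sub>2 = (\<Prod>i<k\<^sub>1. (\<alpha> (i, 0))\<^sup>2) * (\<Prod>j<k\<^sub>2. (\<beta> (k\<^sub>1, j))\<^sup>2)"

definition berger_measure_2 ::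
  "(nat \<times> nat \<Rightarrow> real) \<Rightarrow> (nat \<times> nat \<Rightarrow> real) \<Rightarrow> (real \<times> real) measure \<Rightarrow> bool" where
  "berger_measure_2 \<alpha> \<beta> \<mu> \<longleftrightarrow>
     prob_space \<mu> \<and> sets \<mu> = sets borel \<and>
     (AE p in \<mu>. p \<in> {0..(ell2_opnorm (shift1 \<alpha>))\<^sup>2} \<times> {0..(ell2_opnorm (shift2 \<beta>))\<^sup>2}) \<and>
     (\<forall>k\<^sub>1 k\<^sub>2. moment2 \<alpha> \<beta> k\<^sub>1 k\<^sub>2 = (\<integral>(s, t). s ^ k\<^sub>1 * t ^ k\<^sub>2 \<partial>\<mu>))"

text \<open>The spherical isometry property of the pair follows from this moment formula.\<close>

definition spherically_isometric_embedding ::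
  "(nat \<Rightarrow> real) \<Rightarrow> (nat \<times> nat \<Rightarrow> real) \<Rightarrow> (nat \<times> nat \<Rightarrow> real) \<Rightarrow> bool" where
  "spherically_isometric_embedding \<omega> \<alpha> \<beta> \<longleftrightarrow>
     shift_weights \<omega> \<and> shift_weights_2 \<alpha> \<beta> \<and>
     (\<exists>\<sigma>. berger_measure \<omega> \<sigma> \<and> (AE r in \<sigma>. r \<in> {0..1}) \<and>
        (\<forall>k\<^sub>1 k\<^sub>2. moment2 \<alpha> \<beta> k\<^sub>1 k\<^sub>2 = (\<integral>r. r ^ k\<^sub>1 * (1 - r) ^ k\<^sub>2 \<partial>\<sigma>)))"


section \<open>Arclength\<close>

text \<open>The push-forward of \<open>\<bar>g'(t)\<bar> dt\<close> along \<open>g\<close>, for a parametrisation \<open>g\<close> on \<open>[0, 1]\<close>.\<close>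

definition path_arclength :: "(real \<Rightarrow> 'a::euclidean_space) \<Rightarrow> 'a measure" where
  "path_arclength g =
     distr (density (restrict_space lborel {0..1}) (\<lambda>t. ennreal (norm (vector_derivative g (at t)))))
       borel g"

text \<open>The arclength measure of a set \<open>C\<close> that is the image of an injective \<open>C\<^sup>1\<close> path. It does not
  depend on which such parametrisation is used, and it is a measure on the ambient space that is
  concentrated on \<open>C\<close>.\<close>

definition arclength_on :: "'a::euclidean_space set \<Rightarrow> 'a measure \<Rightarrow> bool" where
  "arclength_on C \<nu> \<longleftrightarrow>
     (\<exists>g. arc g \<and> g C1_differentiable_on {0..1} \<and> path_image g = C \<and> \<nu> = path_arclength g)"

definition normalized_arclength_on :: "'a::euclidean_space set \<Rightarrow> 'a measure \<Rightarrow> bool" where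
  "normalized_arclength_on C \<mu> \<longleftrightarrow>
     (\<exists>\<nu>. arclength_on C \<nu> \<and> \<mu> = scale_measure (inverse (emeasure \<nu> (space \<nu>))) \<nu>)"

end

theory Submission
  imports Defs
begin

text \<open>
  Let \<open>\<sigma>\<close> be Lebesgue measure on \<open>[0, 1]\<close>. The moments demanded of a spherically isometric embedding
  are the Beta integrals \<open>\<integral> r\<^sup>m (1 - r)\<^sup>n dr = m! n! / (m + n + 1)!\<close>. The ratios of
  neighbouring moments are the squares of the weights, so the weights are forced to be
  \<open>\<alpha>\<^sup>2 = (m + 1) / (m + n + 2)\<close> and \<open>\<beta>\<^sup>2 = (n + 1) / (m + n + 2)\<close> at \<open>(m, n)\<close>. The numerators add
  up to the denominator, which is the spherical isometry condition, and the row \<open>n = 0\<close> of \<open>\<alpha>\<close>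
  consists of the Bergman weights.

  Substituting \<open>s = r\<close>, \<open>t = 1 - r\<close> turns the Beta integral into the integral of \<open>s\<^sup>m t\<^sup>n\<close> against the
  image of \<open>\<sigma>\<close> under \<open>r \<mapsto> (r, 1 - r)\<close>. This map runs through the segment \<open>s + t = 1\<close> at constant
  speed, so the image of \<open>\<sigma>\<close> is arclength up to a factor, and total mass \<open>1\<close> fixes the factor
  (\<open>normalized_arclength_on_closed_segment\<close>).

  A Berger measure must in addition be carried by the box whose sides are the squared operator norms.
  Each shift involved carries the unit vectors to multiples of unit vectors, with weights that approach
  \<open>1\<close>; its norm is therefore at least \<open>1\<close> (\<open>opnorm_ge_1\<close>), and the box contains the unit square.
\<close>

section \<open>Weighted translations on square-summable families\<close>

text \<open>The unilateral shift and both coordinates of a 2-variable shift move the basis along an injective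
  map \<open>f\<close> of the index set and multiply by weights. Norms and adjoints depend on nothing else.\<close>

locale weighted_translation =
  fixes f :: "'a \<Rightarrow> 'a" and w :: "'a \<Rightarrow> real" and T :: "('a \<Rightarrow> complex) \<Rightarrow> 'a \<Rightarrow> complex"
  assumes inj_f: "inj f"
    and T_image: "T x (f k) = of_real (w k) * x k"
    and T_off_range: "l \<notin> range f \<Longrightarrow> T x l = 0"
    and w_nonneg: "0 \<le> w k"
    and w_le_1: "w k \<le> 1"
begin

lemma cmod_T_image_le: "(cmod (T x (f k)))\<^sup>2 \<le> (cmod (x k))\<^sup>2"
  using w_nonneg[of k] w_le_1[of k]
  by (auto simp: T_image norm_mult intro!: power_mono mult_left_le_one_le)

lemma summable_iff_on_image:
  assumes "\<And>l. l \<notin> range f \<Longrightarrow> h l = 0"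
  shows "h summable_on UNIV \<longleftrightarrow> (\<lambda>k. h (f k)) summable_on UNIV"
proof -
  have "h summable_on UNIV \<longleftrightarrow> h summable_on range f"
    using assms by (intro summable_on_cong_neutral) auto
  thus ?thesis using summable_on_reindex[OF inj_f, of h] by (simp add: o_def)
qed

lemma infsum_eq_on_image:
  fixes h :: "'a \<Rightarrow> 'b::{comm_monoid_add, t2_space}"
  assumes "\<And>l. l \<notin> range f \<Longrightarrow> h l = 0"
  shows "(\<Sum>\<^sub>\<infinity>l. h l) = (\<Sum>\<^sub>\<infinity>k. h (f k))"
proof -
  have "infsum h UNIV = infsum h (range f)"
    using assms by (intro infsum_cong_neutral) auto
  thus ?thesis using infsum_reindex[OF inj_f, of h] by (simp add: o_def)
qed

lemma T_in_ell2:
  assumes "x \<in> ell2"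
  shows "T x \<in> ell2"
proof -
  have "(\<lambda>k. (cmod (T x (f k)))\<^sup>2) summable_on UNIV"
    by (rule summable_on_comparison_test[of "\<lambda>k. (cmod (x k))\<^sup>2"])
       (use assms cmod_T_image_le in \<open>auto simp: ell2_def\<close>)
  thus ?thesis
    using summable_iff_on_image[of "\<lambda>l. (cmod (T x l))\<^sup>2"] T_off_range by (simp add: ell2_def)
qed

lemma norm_T_le:
  assumes "x \<in> ell2"
  shows "ell2_norm (T x) \<le> ell2_norm x"
proof -
  have *: "(\<lambda>k. (cmod (T x (f k)))\<^sup>2) summable_on UNIV"
    using T_in_ell2[OF assms] summable_iff_on_image[of "\<lambda>l. (cmod (T x l))\<^sup>2"] T_off_range
    by (simp add: ell2_def)
  have "(\<Sum>\<^sub>\<infinity>l. (cmod (T x l))\<^sup>2) = (\<Sum>\<^sub>\<infinity>k. (cmod (T x (f k)))\<^sup>2)"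
    by (rule infsum_eq_on_image) (simp add: T_off_range)
  also have "\<dots> \<le> (\<Sum>\<^sub>\<infinity>k. (cmod (x k))\<^sup>2)"
    using assms cmod_T_image_le by (intro infsum_mono *) (auto simp: ell2_def)
  finally show ?thesis by (simp add: ell2_norm_def)
qed

lemma adjoint_of_T: "ell2_adjoint_of T (\<lambda>y k. of_real (w k) * y (f k))"
  unfolding ell2_adjoint_of_def
proof (intro conjI ballI)
  fix x y :: "'a \<Rightarrow> complex"
  show "ell2_inner (T x) y = ell2_inner x (\<lambda>k. of_real (w k) * y (f k))"
    unfolding ell2_inner_def
    by (subst infsum_eq_on_image) (simp_all add: T_off_range T_image mult_ac)
next
  fix y :: "'a \<Rightarrow> complex" assume y: "y \<in> ell2"
  show "T y \<in> ell2" by (rule T_in_ell2[OF y])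
  have "(\<lambda>l. (cmod (y l))\<^sup>2) summable_on range f"
    using y by (auto simp: ell2_def intro: summable_on_subset_banach)
  hence s: "(\<lambda>k. (cmod (y (f k)))\<^sup>2) summable_on UNIV"
    using summable_on_reindex[OF inj_f, of "\<lambda>l. (cmod (y l))\<^sup>2"] by (simp add: o_def)
  have "(cmod (of_real (w k) * y (f k)))\<^sup>2 \<le> (cmod (y (f k)))\<^sup>2" for k
    using w_nonneg[of k] w_le_1[of k]
    by (auto simp: norm_mult intro!: power_mono mult_left_le_one_le)
  hence "(\<lambda>k. (cmod (of_real (w k) * y (f k)))\<^sup>2) summable_on UNIV"
    by (intro summable_on_comparison_test[OF s]) auto
  thus "(\<lambda>k. of_real (w k) * y (f k)) \<in> ell2" by (simp add: ell2_def)
qed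

text \<open>The supremum defining the norm is meaningful because \<open>T\<close> is a contraction; it is then tested on
  the basis vector at \<open>k\<close>, which is sent to \<open>w k\<close> times the basis vector at \<open>f k\<close>.\<close>

lemma weight_le_opnorm: "w k \<le> ell2_opnorm T"
proof -
  define e :: "'a \<Rightarrow> complex" where "e = (\<lambda>i. of_bool (i = k))"
  have "(\<lambda>i. (cmod (e i))\<^sup>2) summable_on UNIV"
    by (rule finite_nonzero_values_imp_summable_on) (simp add: e_def)
  hence e: "e \<in> ell2" by (simp add: ell2_def)
  have "(\<Sum>\<^sub>\<infinity>i. (cmod (e i))\<^sup>2) = (\<Sum>\<^sub>\<infinity>i\<in>{k}. (cmod (e i))\<^sup>2)"
    by (rule infsum_cong_neutral) (auto simp: e_def)
  hence ne: "ell2_norm e = 1" by (simp add: ell2_norm_def e_def)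
  have "(\<Sum>\<^sub>\<infinity>l. (cmod (T e l))\<^sup>2) = (\<Sum>\<^sub>\<infinity>i. (cmod (T e (f i)))\<^sup>2)"
    by (rule infsum_eq_on_image) (simp add: T_off_range)
  also have "\<dots> = (\<Sum>\<^sub>\<infinity>i\<in>{k}. (cmod (T e (f i)))\<^sup>2)"
    by (rule infsum_cong_neutral) (auto simp: e_def T_image)
  finally have "ell2_norm (T e) = w k"
    using w_nonneg[of k] by (simp add: ell2_norm_def e_def T_image norm_mult)
  moreover have "ell2_norm (T e) \<le> ell2_opnorm T"
    unfolding ell2_opnorm_def
  proof (rule cSUP_upper)
    show "e \<in> {x \<in> ell2. ell2_norm x \<le> 1}" using e ne by simp
    show "bdd_above ((\<lambda>x. ell2_norm (T x)) ` {x \<in> ell2. ell2_norm x \<le> 1})"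
      by (rule bdd_aboveI[of _ 1]) (auto intro: order_trans[OF norm_T_le])
  qed
  ultimately show ?thesis by simp
qed

lemma opnorm_ge_1:
  assumes "(\<lambda>n. w (k n)) \<longlonglongrightarrow> 1"
  shows "1 \<le> ell2_opnorm T"
  using LIMSEQ_le_const2[OF assms] weight_le_opnorm by blast

end

text \<open>\<open>T\<^sub>1\<^sup>* T\<^sub>1 + T\<^sub>2\<^sup>* T\<^sub>2\<close> is the diagonal operator with entries \<open>w\<^sub>1\<^sup>2 + w\<^sub>2\<^sup>2\<close>.\<close>

lemma spherical_isometry_weighted_translations:
  assumes "weighted_translation f\<^sub>1 w\<^sub>1 T\<^sub>1" "weighted_translation f\<^sub>2 w\<^sub>2 T\<^sub>2"
    and sum_1: "\<And>k. (w\<^sub>1 k)\<^sup>2 + (w\<^sub>2 k)\<^sup>2 = 1"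
  shows "spherical_isometry T\<^sub>1 T\<^sub>2"
proof -
  interpret T1: weighted_translation f\<^sub>1 w\<^sub>1 T\<^sub>1 by fact
  interpret T2: weighted_translation f\<^sub>2 w\<^sub>2 T\<^sub>2 by fact
  have "complex_of_real (w\<^sub>1 k) * T\<^sub>1 x (f\<^sub>1 k) + of_real (w\<^sub>2 k) * T\<^sub>2 x (f\<^sub>2 k) = x k" for x k
  proof -
    have "complex_of_real (w\<^sub>1 k) * T\<^sub>1 x (f\<^sub>1 k) + of_real (w\<^sub>2 k) * T\<^sub>2 x (f\<^sub>2 k)
        = of_real ((w\<^sub>1 k)\<^sup>2 + (w\<^sub>2 k)\<^sup>2) * x k"
      by (simp add: T1.T_image T2.T_image power2_eq_square algebra_simps)
    thus ?thesis by (simp add: sum_1)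
  qed
  thus ?thesis
    unfolding spherical_isometry_def using T1.adjoint_of_T T2.adjoint_of_T by blast
qed

lemma weighted_translation_weighted_shift:
  assumes "\<And>k. 0 \<le> w k" "\<And>k. w k \<le> 1"
  shows "weighted_translation Suc w (weighted_shift w)"
proof
  show "weighted_shift w x l = 0" if "l \<notin> range Suc" for x l
    using that by (cases l) (auto simp: weighted_shift_def)
qed (use assms in \<open>auto simp: weighted_shift_def\<close>)

lemma weighted_translation_shift1:
  assumes "\<And>k. 0 \<le> w k" "\<And>k. w k \<le> 1"
  shows "weighted_translation (\<lambda>(i, j). (Suc i, j)) w (shift1 w)"
proof
  show "shift1 w x l = 0" if "l \<notin> range (\<lambda>(i, j). (Suc i, j))" for x l
  proof (cases l)
    case (Pair i j)
    with that show ?thesis by (cases i) (auto simp: shift1_def image_iff)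
  qed
qed (use assms in \<open>auto simp: shift1_def inj_def split: prod.splits\<close>)

lemma weighted_translation_shift2:
  assumes "\<And>k. 0 \<le> w k" "\<And>k. w k \<le> 1"
  shows "weighted_translation (\<lambda>(i, j). (i, Suc j)) w (shift2 w)"
proof
  show "shift2 w x l = 0" if "l \<notin> range (\<lambda>(i, j). (i, Suc j))" for x l
  proof (cases l)
    case (Pair i j)
    with that show ?thesis by (cases j) (auto simp: shift2_def image_iff)
  qed
qed (use assms in \<open>auto simp: shift2_def inj_def split: prod.splits\<close>)

lemma shift1_shift2_commute:
  assumes "\<And>i j. \<beta> (i, j) * \<alpha> (i, Suc j) = \<alpha> (i, j) * \<beta> (Suc i, j)"
  shows "shift1 \<alpha> (shift2 \<beta> x) = shift2 \<beta> (shift1 \<alpha> x)"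
proof
  fix l :: "nat \<times> nat"
  obtain i j where l: "l = (i, j)" by (cases l)
  have "complex_of_real (\<alpha> (a, Suc b)) * of_real (\<beta> (a, b))
      = of_real (\<beta> (Suc a, b)) * of_real (\<alpha> (a, b))" for a b
    using assms[of a b] by (metis mult.commute of_real_mult)
  thus "shift1 \<alpha> (shift2 \<beta> x) l = shift2 \<beta> (shift1 \<alpha> x) l"
    unfolding l shift1_def shift2_def by (auto split: nat.split simp flip: mult.assoc)
qed

section \<open>The Bergman shift and its embedding\<close>

definition bergman_alpha :: "nat \<times> nat \<Rightarrow> real" where
  "bergman_alpha = (\<lambda>(i, j). sqrt ((real i + 1) / (real i + real j + 2)))"

definition bergman_beta :: "nat \<times> nat \<Rightarrow> real" where
  "bergman_beta = (\<lambda>(i, j). sqrt ((real j + 1) / (real i + real j + 2)))"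

lemma bergman_alpha_pos: "0 < bergman_alpha k"
  by (auto simp: bergman_alpha_def split: prod.split)

lemma bergman_beta_pos: "0 < bergman_beta k"
  by (auto simp: bergman_beta_def split: prod.split)

lemma bergman_alpha_le_1: "bergman_alpha k \<le> 1"
  by (auto simp: bergman_alpha_def split: prod.split)

lemma bergman_beta_le_1: "bergman_beta k \<le> 1"
  by (auto simp: bergman_beta_def split: prod.split)

lemma bergman_weights_eq_alpha: "bergman_weights n = bergman_alpha (n, 0)"
  by (simp add: bergman_weights_def bergman_alpha_def)

lemma bergman_spherical: "(bergman_alpha k)\<^sup>2 + (bergman_beta k)\<^sup>2 = 1"
  by (auto simp: bergman_alpha_def bergman_beta_def divide_simps split: prod.split)

lemma bergman_weights_tendsto: "bergman_weights \<longlonglongrightarrow> 1"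
proof -
  have "(\<lambda>n. sqrt (real (Suc n) / real (Suc (Suc n)))) \<longlonglongrightarrow> sqrt 1"
    by (intro tendsto_real_sqrt LIMSEQ_Suc[OF LIMSEQ_n_over_Suc_n])
  moreover have "bergman_weights = (\<lambda>n. sqrt (real (Suc n) / real (Suc (Suc n))))"
    by (simp add: bergman_weights_def fun_eq_iff add_ac)
  ultimately show ?thesis by simp
qed

lemma shift_weights_bergman: "shift_weights bergman_weights"
  unfolding shift_weights_def bergman_weights_eq_alpha
  using bergman_alpha_pos bergman_alpha_le_1 by (auto intro!: bdd_aboveI[of _ 1])

lemma shift_weights_2_bergman: "shift_weights_2 bergman_alpha bergman_beta"
proof -
  have "shift1 bergman_alpha (shift2 bergman_beta x) = shift2 bergman_beta (shift1 bergman_alpha x)"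
    for x
    by (rule shift1_shift2_commute)
       (simp add: bergman_alpha_def bergman_beta_def add_ac flip: real_sqrt_mult)
  thus ?thesis
    unfolding shift_weights_2_def
    using bergman_alpha_pos bergman_alpha_le_1 bergman_beta_pos bergman_beta_le_1
    by (auto intro!: bdd_aboveI[of _ 1])
qed

text \<open>The path defining \<open>moment2\<close> runs along the first axis, where the product telescopes to
  \<open>1 / (m + 1)\<close>, and then upwards.\<close>

lemma moment2_bergman:
  "moment2 bergman_alpha bergman_beta m n = fact m * fact n / fact (m + n + 1)"
proof -
  have a: "(\<Prod>i<m. (bergman_alpha (i, 0))\<^sup>2) = 1 / (real m + 1)"
    by (induction m) (auto simp: bergman_alpha_def divide_simps)
  have b: "(\<Prod>j<n. (bergman_beta (m, j))\<^sup>2) = fact (m + 1) * fact n / fact (m + n + 1)"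
  proof (induction n)
    case (Suc n)
    have "(bergman_beta (m, n))\<^sup>2 = (real n + 1) / (real m + real n + 2)"
      by (simp add: bergman_beta_def)
    moreover have "(fact (Suc n) :: real) = fact n * (real n + 1)"
      "(fact (m + Suc n + 1) :: real) = fact (m + n + 1) * (real m + real n + 2)"
      by (simp_all add: algebra_simps)
    ultimately show ?case
      by (simp only: prod.lessThan_Suc Suc.IH times_divide_times_eq mult.assoc)
  qed simp
  show ?thesis
    unfolding moment2_def a b by (simp add: divide_simps)
qed

lemma moment_bergman: "moment bergman_weights k = moment2 bergman_alpha bergman_beta k 0"
  by (simp add: moment_def moment2_def bergman_weights_eq_alpha)

section \<open>Lebesgue measure on the unit interval\<close>

abbreviation unit_lebesgue :: "real measure" where
  "unit_lebesgue \<equiv> uniform_measure lborel {0..1}"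

lemma prob_space_unit_lebesgue: "prob_space unit_lebesgue"
  by (rule prob_space_uniform_measure) auto

lemma AE_unit_lebesgue: "AE r in unit_lebesgue. r \<in> {0..1}"
  by (rule AE_uniform_measureI) auto

lemma has_integral_power_mult_power:
  "((\<lambda>r::real. r ^ m * (1 - r) ^ n) has_integral fact m * fact n / fact (m + n + 1)) {0..1}"
proof -
  have "Beta (real m + 1) (real n + 1) = fact m * fact n / fact (m + n + 1)"
    using Gamma_fact[of m, where ?'a = real] Gamma_fact[of n, where ?'a = real]
      Gamma_fact[of "m + n + 1", where ?'a = real]
    by (simp add: Beta_def add_ac)
  hence I: "((\<lambda>r::real. r powr (real m + 1 - 1) * (1 - r) powr (real n + 1 - 1)) has_integral
      fact m * fact n / fact (m + n + 1)) {0..1}"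
    using has_integral_Beta_real[of "real m + 1" "real n + 1"] by simp
  \<comment> \<open>At the end points \<open>0 powr 0 = 0\<close> but \<open>0 ^ 0 = 1\<close>.\<close>
  show ?thesis
    by (rule has_integral_spike_finite[OF _ _ I, of "{0, 1}"]) (auto simp: powr_realpow)
qed

lemma integral_unit_lebesgue_power_mult_power:
  "(\<integral>r. r ^ m * (1 - r) ^ n \<partial>unit_lebesgue) = fact m * fact n / fact (m + n + 1)"
proof -
  have eq: "unit_lebesgue = density lborel (\<lambda>x. ennreal (indicator {0..1} x))"
    by (simp add: uniform_measure_def ennreal_indicator divide_ennreal_def)
  have i: "set_integrable lborel {0..1} (\<lambda>r::real. r ^ m * (1 - r) ^ n)"
    by (intro borel_integrable_atLeastAtMost' continuous_intros)
  have "(\<integral>r. r ^ m * (1 - r) ^ n \<partial>unit_lebesgue) = (LINT r:{0..1}|lborel. r ^ m * (1 - r) ^ n)"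
    unfolding eq set_lebesgue_integral_def by (subst integral_density) auto
  also have "\<dots> = integral {0..1} (\<lambda>r. r ^ m * (1 - r) ^ n)"
    by (rule set_borel_integral_eq_integral(2)[OF i])
  also have "\<dots> = fact m * fact n / fact (m + n + 1)"
    by (rule integral_unique[OF has_integral_power_mult_power])
  finally show ?thesis .
qed

lemma berger_measure_bergman: "berger_measure bergman_weights unit_lebesgue"
proof -
  interpret W: weighted_translation Suc bergman_weights "weighted_shift bergman_weights"
    by (rule weighted_translation_weighted_shift)
       (auto simp: bergman_weights_eq_alpha bergman_alpha_le_1 less_imp_le[OF bergman_alpha_pos])
  have "1 \<le> (ell2_opnorm (weighted_shift bergman_weights))\<^sup>2"
    using W.opnorm_ge_1[OF bergman_weights_tendsto] by (simp add: one_le_power)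
  hence "AE r in unit_lebesgue. r \<in> {0..(ell2_opnorm (weighted_shift bergman_weights))\<^sup>2}"
    by (intro eventually_mono[OF AE_unit_lebesgue]) auto
  moreover have "moment bergman_weights k = (\<integral>r. r ^ k \<partial>unit_lebesgue)" for k
    using integral_unit_lebesgue_power_mult_power[of k 0] by (simp add: moment_bergman moment2_bergman)
  ultimately show ?thesis
    by (simp add: berger_measure_def prob_space_unit_lebesgue)
qed

section \<open>Arclength on a segment\<close>

text \<open>A linear path has constant speed \<open>norm (b - a)\<close>, which is also its length, so normalizing cancels
  the speed and leaves the image of Lebesgue measure.\<close>

lemma normalized_arclength_on_closed_segment:
  fixes a b :: "'a::euclidean_space"
  assumes "a \<noteq> b"
  shows "normalized_arclength_on (closed_segment a b) (distr unit_lebesgue borel (linepath a b))"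
proof -
  define \<nu> where "\<nu> = path_arclength (linepath a b)"
  define c where "c = ennreal (norm (b - a))"
  have meas [measurable]: "linepath a b \<in> borel_measurable borel"
    by (intro borel_measurable_continuous_onI continuous_on_linepath)
  have \<nu>: "emeasure \<nu> A = c * emeasure lborel ({0..1} \<inter> linepath a b -` A)"
    if A: "A \<in> sets borel" for A
  proof -
    have *: "linepath a b -` A \<in> sets borel"
      using measurable_sets[OF meas A] by simp
    have "emeasure \<nu> A = emeasure (density (restrict_space lborel {0..1}) (\<lambda>_. c))
        ({0..1} \<inter> linepath a b -` A)"
      unfolding \<nu>_def path_arclength_def c_def using A
      by (subst emeasure_distr)
         (auto simp: space_restrict_space Int_commute intro!: measurable_restrict_space1)
    also have "\<dots> = c * emeasure (restrict_space lborel {0..1}) ({0..1} \<inter> linepath a b -` A)"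
      using * by (intro emeasure_density_const) (auto simp: sets_restrict_space)
    also have "\<dots> = c * emeasure lborel ({0..1} \<inter> linepath a b -` A)"
      by (subst emeasure_restrict_space) auto
    finally show ?thesis .
  qed
  have sets_\<nu>: "sets \<nu> = sets borel" by (simp add: \<nu>_def path_arclength_def)
  have "emeasure \<nu> (space \<nu>) = c"
    using \<nu>[of UNIV] sets_eq_imp_space_eq[OF sets_\<nu>] by simp
  moreover have "distr unit_lebesgue borel (linepath a b) = scale_measure (inverse c) \<nu>"
  proof (rule measure_eqI)
    show "sets (distr unit_lebesgue borel (linepath a b)) = sets (scale_measure (inverse c) \<nu>)"
      by (simp add: sets_\<nu>)
    fix A assume "A \<in> sets (distr unit_lebesgue borel (linepath a b))"
    hence A: "A \<in> sets borel" by simp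
    have "inverse c * c = 1"
      using assms by (simp add: c_def inverse_ennreal flip: ennreal_mult'')
    hence "inverse c * (c * z) = z" for z by (simp flip: mult.assoc)
    moreover have "emeasure (distr unit_lebesgue borel (linepath a b)) A
        = emeasure lborel ({0..1} \<inter> linepath a b -` A)"
      using A measurable_sets[OF meas A] by (subst emeasure_distr) (auto simp: divide_ennreal_def)
    ultimately show "emeasure (distr unit_lebesgue borel (linepath a b)) A
        = emeasure (scale_measure (inverse c) \<nu>) A"
      by (simp add: \<nu>[OF A])
  qed
  moreover have "arclength_on (closed_segment a b) \<nu>"
    unfolding arclength_on_def \<nu>_def
  proof (intro exI conjI)
    show "arc (linepath a b)" using assms by (rule arc_linepath)
    show "linepath a b C1_differentiable_on {0..1}"
      by (auto simp: C1_differentiable_on_def intro!: exI[of _ "\<lambda>_. b - a"]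
          has_vector_derivative_linepath_within)
    show "path_image (linepath a b) = closed_segment a b" by simp
  qed (rule refl)
  ultimately show ?thesis
    unfolding normalized_arclength_on_def by metis
qed

section \<open>The Berger measure of the embedding\<close>

lemma linepath_unit_simplex: "linepath (0, 1) (1, 0) r = (r, 1 - r :: real)"
  by (simp add: linepath_def)

lemma closed_segment_unit_simplex:
  "closed_segment (0, 1) (1, 0) = {(s, t). 0 \<le> s \<and> 0 \<le> t \<and> s + t = (1 :: real)}"
  unfolding path_image_linepath[symmetric] path_image_def image_def linepath_unit_simplex
  by (auto simp: algebra_simps)

lemma berger_measure_2_bergman:
  "berger_measure_2 bergman_alpha bergman_beta (distr unit_lebesgue borel (linepath (0, 1) (1, 0)))"
    (is "berger_measure_2 _ _ ?\<mu>")
proof -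
  interpret T1: weighted_translation "\<lambda>(i, j). (Suc i, j)" bergman_alpha "shift1 bergman_alpha"
    by (intro weighted_translation_shift1 bergman_alpha_le_1 less_imp_le[OF bergman_alpha_pos])
  interpret T2: weighted_translation "\<lambda>(i, j). (i, Suc j)" bergman_beta "shift2 bergman_beta"
    by (intro weighted_translation_shift2 bergman_beta_le_1 less_imp_le[OF bergman_beta_pos])
  have meas: "linepath (0, 1) (1, 0) \<in> unit_lebesgue \<rightarrow>\<^sub>M (borel :: (real \<times> real) measure)"
    by (simp add: borel_measurable_continuous_onI continuous_on_linepath
        cong: measurable_cong_sets)
  have "(\<lambda>n. bergman_alpha (n, 0)) \<longlonglongrightarrow> 1" "(\<lambda>n. bergman_beta (0, n)) \<longlonglongrightarrow> 1"
    using bergman_weights_tendsto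
    by (simp_all add: bergman_weights_def[abs_def] bergman_alpha_def bergman_beta_def)
  hence n: "1 \<le> (ell2_opnorm (shift1 bergman_alpha))\<^sup>2" "1 \<le> (ell2_opnorm (shift2 bergman_beta))\<^sup>2"
    using T1.opnorm_ge_1 T2.opnorm_ge_1 by (simp_all add: one_le_power)
  let ?box = "{0..(ell2_opnorm (shift1 bergman_alpha))\<^sup>2} \<times> {0..(ell2_opnorm (shift2 bergman_beta))\<^sup>2}"
  have "AE p in ?\<mu>. p \<in> ?box"
  proof (subst AE_distr_iff)
    show "{p \<in> space borel. p \<in> ?box} \<in> sets borel"
      by (simp add: borel_closed closed_Times)
    show "AE r in unit_lebesgue. linepath (0, 1) (1, 0) r \<in> ?box"
      by (intro eventually_mono[OF AE_unit_lebesgue]) (use n in \<open>auto simp: linepath_unit_simplex\<close>)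
  qed (rule meas)
  moreover have "prob_space ?\<mu>"
    by (rule prob_space.prob_space_distr[OF prob_space_unit_lebesgue meas])
  moreover have "moment2 bergman_alpha bergman_beta m n = (\<integral>(s, t). s ^ m * t ^ n \<partial>?\<mu>)" for m n
  proof (subst integral_distr)
    show "(\<lambda>(s, t). s ^ m * t ^ n) \<in> borel_measurable (borel :: (real \<times> real) measure)"
      unfolding case_prod_beta by (intro borel_measurable_continuous_onI continuous_intros)
  qed (simp_all add: meas linepath_unit_simplex moment2_bergman
      integral_unit_lebesgue_power_mult_power)
  ultimately show ?thesis
    by (simp add: berger_measure_2_def)
qed

theorem theorem1p7:
  "\<exists>\<alpha> \<beta> :: nat \<times> nat \<Rightarrow> real.
     spherically_isometric_embedding bergman_weights \<alpha> \<beta> \<and>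
     spherical_isometry (shift1 \<alpha>) (shift2 \<beta>) \<and>
     (\<exists>\<mu>. normalized_arclength_on {(s, t). 0 \<le> s \<and> 0 \<le> t \<and> s + t = 1} \<mu> \<and>
          berger_measure_2 \<alpha> \<beta> \<mu>)"
proof (intro exI conjI)
  show "spherically_isometric_embedding bergman_weights bergman_alpha bergman_beta"
    unfolding spherically_isometric_embedding_def
    using shift_weights_bergman shift_weights_2_bergman berger_measure_bergman AE_unit_lebesgue
    by (auto simp: moment2_bergman integral_unit_lebesgue_power_mult_power)
  show "spherical_isometry (shift1 bergman_alpha) (shift2 bergman_beta)"
    by (rule spherical_isometry_weighted_translations[OF weighted_translation_shift1
          weighted_translation_shift2 bergman_spherical])
       (simp_all add: bergman_alpha_le_1 bergman_beta_le_1
          less_imp_le[OF bergman_alpha_pos] less_imp_le[OF bergman_beta_pos])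
  show "normalized_arclength_on {(s, t). 0 \<le> s \<and> 0 \<le> t \<and> s + t = 1}
      (distr unit_lebesgue borel (linepath (0, 1) (1, 0)) :: (real \<times> real) measure)"
    using normalized_arclength_on_closed_segment[of "(0, 1) :: real \<times> real" "(1, 0)"]
    by (simp add: closed_segment_unit_simplex)
  show "berger_measure_2 bergman_alpha bergman_beta
      (distr unit_lebesgue borel (linepath (0, 1) (1, 0)))"
    by (rule berger_measure_2_bergman)
qed

end
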